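(* Let $N$ and $l$ be positive integers. Suppose a binary image $F$ consists of $N$ ones and has a boundary of length $l$. Furthermore assume that none of the connected components of $F$ contains any holes. Then $F$ contains a ball of radius $\left\lfloor \frac{N}{l} \right\rfloor$.
   Context: A cell is a unit square in $\mathbb{R}^2$ whose vertices have integer coordinates. A binary image is a (finite) rectangle in $\mathbb{R}^2$ made up of cells, in which each cell has been assigned a value $0$ or $1$. A cell with value $1$ is called a one, a cell with value $0$ a zero; the image consists of $N$ ones if exactly $N$ of its cells have value $1$. Two cells are neighbours if they have a common edge (only this adjacency is used). Two ones $c, c'$ are connected if there is a path $c=c_1,\dots,c_n=c'$ of ones with $c_i$ and $c_{i+1}$ neighbours for $1\le i\le n-1$; the equivalence classes of this relation are the connected components of the image. A connected component $K$ contains a hole if there is a zero or a group of zeroes that is completely surrounded by ones of $K$, that is, if there is a zero in the rectangle such that every path of successively neighbouring cells from it to a cell outside the rectangle passes through a one belonging to $K$. An edge of a cell belongs to the boundary of the image if it is the common edge of two neighbouring cells of the rectangle, one with value $1$ and one with value $0$, or if it belongs to exactly one cell of the rectangle (i.e. lies on the outer edge of the rectangle) and that cell has value $1$. The length of the boundary is the number of edges belonging to the boundary. For each one $c$, the distance to the boundary $d(c)$ is defined recursively: $d(c)=0$ if at least one edge of $c$ belongs to the boundary; otherwise $d(c)=1+\min\{d(c') : c' \text{ and } c \text{ are neighbours}\}$ (in that case all four neighbours of $c$ are ones). Equivalently, $d(c)$ is the least number of steps between neighbouring ones needed to get from $c$ to a one having an edge in the boundary. The image contains a ball with radius $k$ if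 there is a one $c$ with $d(c)\ge k$. *)

theory Defs
  imports Complex_Main
begin

text \<open>
  The lattice point \<open>(x, y)\<close> stands for the cell \<open>[x, x + 1] \<times> [y, y + 1]\<close>, i.e. a cell is
  represented by its lower left vertex; an edge is represented by the set of its two end points.
\<close>

type_synonym cell = "int \<times> int"
type_synonym edge = "(int \<times> int) set"

definition cell_edges :: "cell \<Rightarrow> edge set" where
  "cell_edges c = (case c of (x, y) \<Rightarrow>
     {{(x, y), (x + 1, y)}, {(x, y + 1), (x + 1, y + 1)},
      {(x, y), (x, y + 1)}, {(x + 1, y), (x + 1, y + 1)}})"

definition neighbours :: "cell \<Rightarrow> cell \<Rightarrow> bool" where
  "neighbours c c' \<longleftrightarrow> c \<noteq> c' \<and> cell_edges c \<inter> cell_edges c' \<noteq> {}"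

definition cell_path :: "cell list \<Rightarrow> cell \<Rightarrow> cell \<Rightarrow> bool" where
  "cell_path p c c' \<longleftrightarrow> p \<noteq> [] \<and> hd p = c \<and> last p = c' \<and> successively neighbours p"

text \<open>
  The rectangle is \<open>[xmin, xmax] \<times> [ymin, ymax]\<close>; \<open>cell_value\<close> is irrelevant outside of it.
\<close>

record binary_image =
  xmin :: int
  xmax :: int
  ymin :: int
  ymax :: int
  cell_value :: "cell \<Rightarrow> nat"

definition image_cells :: "binary_image \<Rightarrow> cell set" where
  "image_cells F = {xmin F..<xmax F} \<times> {ymin F..<ymax F}"

definition is_binary_image :: "binary_image \<Rightarrow> bool" where
  "is_binary_image F \<longleftrightarrow> xmin F < xmax F \<and> ymin F < ymax F \<and>
     (\<forall>c\<in>image_cells F. cell_value F c \<in> {0, 1})"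

definition ones :: "binary_image \<Rightarrow> cell set" where
  "ones F = {c \<in> image_cells F. cell_value F c = 1}"

definition zeroes :: "binary_image \<Rightarrow> cell set" where
  "zeroes F = {c \<in> image_cells F. cell_value F c = 0}"

definition connected_ones :: "binary_image \<Rightarrow> (cell \<times> cell) set" where
  "connected_ones F = {(c, c'). \<exists>p. cell_path p c c' \<and> set p \<subseteq> ones F}"

definition image_components :: "binary_image \<Rightarrow> cell set set" where
  "image_components F = ones F // connected_ones F"

definition has_hole :: "binary_image \<Rightarrow> cell set \<Rightarrow> bool" where
  "has_hole F K \<longleftrightarrow> (\<exists>z\<in>zeroes F. \<forall>c p. c \<notin> image_cells F \<and> cell_path p z c \<longrightarrow> set p \<inter> K \<noteq> {})"

definition image_boundary :: "binary_image \<Rightarrow> edge set" where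
  "image_boundary F =
     {e. \<exists>c\<in>ones F. \<exists>c'\<in>zeroes F. neighbours c c' \<and> e \<in> cell_edges c \<inter> cell_edges c'} \<union>
     {e. \<exists>c\<in>ones F. {c' \<in> image_cells F. e \<in> cell_edges c'} = {c}}"

definition boundary_length :: "binary_image \<Rightarrow> nat" where
  "boundary_length F = card (image_boundary F)"

text \<open>
  The recursive equation for the distance does not terminate as a functional program (neighbouring
  cells refer to each other), so the distance is defined as the unique solution of the equation,
  normalised to \<open>0\<close> on cells that are not ones. Existence and uniqueness are proved below
  (\<open>ex1_distance_equations\<close>).
\<close>

definition distance_equations :: "binary_image \<Rightarrow> (cell \<Rightarrow> nat) \<Rightarrow> bool" where
  "distance_equations F d \<longleftrightarrow>
     (\<forall>c\<in>ones F. d c = (if cell_edges c \<inter> image_boundary F \<noteq> {} then 0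
                        else 1 + Min (d ` {c'. neighbours c c'}))) \<and>
     (\<forall>c. c \<notin> ones F \<longrightarrow> d c = 0)"

definition boundary_distance :: "binary_image \<Rightarrow> cell \<Rightarrow> nat" where
  "boundary_distance F = (THE d. distance_equations F d)"

definition contains_ball :: "binary_image \<Rightarrow> nat \<Rightarrow> bool" where
  "contains_ball F k \<longleftrightarrow> (\<exists>c\<in>ones F. boundary_distance F c \<ge> k)"

lemma edge_eq_iff:
  fixes a b u v :: int
  shows "{(a, b), (a + 1, b)} = {(u, v), (u + 1, v)} \<longleftrightarrow> a = u \<and> b = v"
    and "{(a, b), (a, b + 1)} = {(u, v), (u, v + 1)} \<longleftrightarrow> a = u \<and> b = v"
    and "{(a, b), (a + 1, b)} \<noteq> {(u, v), (u, v + 1)}"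
    and "{(a, b), (a, b + 1)} \<noteq> {(u, v), (u + 1, v)}"
  by (auto simp: doubleton_eq_iff)

lemma horizontal_edge_iff: "{(a, b), (a + 1, b)} \<in> cell_edges c \<longleftrightarrow> c = (a, b) \<or> c = (a, b - 1)"
  by (cases c) (auto simp: cell_edges_def edge_eq_iff)

lemma vertical_edge_iff: "{(a, b), (a, b + 1)} \<in> cell_edges c \<longleftrightarrow> c = (a, b) \<or> c = (a - 1, b)"
  by (cases c) (auto simp: cell_edges_def edge_eq_iff)

lemma edge_cases:
  assumes "e \<in> cell_edges c"
  obtains a b where "e = {(a, b), (a + 1, b)}" | a b where "e = {(a, b), (a, b + 1)}"
proof -
  obtain x y where "c = (x, y)" by (cases c)
  then have "e \<in> {{(x, y), (x + 1, y)}, {(x, y + 1), (x + 1, y + 1)},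
      {(x, y), (x, y + 1)}, {(x + 1, y), (x + 1, y + 1)}}"
    using assms by (simp add: cell_edges_def)
  then show thesis using that by blast
qed

lemma neighbours_iff:
  "neighbours (x, y) c' \<longleftrightarrow> c' \<in> {(x + 1, y), (x - 1, y), (x, y + 1), (x, y - 1)}"
proof -
  have *: "cell_edges (x, y) = {{(x, y), (x + 1, y)}, {(x, y + 1), (x + 1, y + 1)},
      {(x, y), (x, y + 1)}, {(x + 1, y), (x + 1, y + 1)}}"
    by (simp add: cell_edges_def)
  show ?thesis
    unfolding neighbours_def *
    by (simp add: Int_insert_left horizontal_edge_iff vertical_edge_iff)
qed

lemma neighbours_sym: "neighbours c c' \<Longrightarrow> neighbours c' c"
  by (auto simp: neighbours_def)

lemma neighbours_set: "finite {c'. neighbours c c'}" "{c'. neighbours c c'} \<noteq> {}"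
proof -
  obtain x y where "c = (x, y)" by (cases c)
  then have "{c'. neighbours c c'} = {(x + 1, y), (x - 1, y), (x, y + 1), (x, y - 1)}"
    by (simp only: neighbours_iff Collect_mem_eq)
  then show "finite {c'. neighbours c c'}" "{c'. neighbours c c'} \<noteq> {}" by simp_all
qed

lemma edge_at_most_two_cells:
  assumes "e \<in> cell_edges c" "e \<in> cell_edges c'" "e \<in> cell_edges c''" "c \<noteq> c'"
  shows "c'' = c \<or> c'' = c'"
  using assms(1)
proof (cases rule: edge_cases)
  case (1 a b)
  then show ?thesis using assms horizontal_edge_iff by metis
next
  case (2 a b)
  then show ?thesis using assms vertical_edge_iff by metis
qed

lemma neighbours_of_interior:
  assumes F: "is_binary_image F" and c: "c \<in> ones F"
    and int: "cell_edges c \<inter> image_boundary F = {}" and nb: "neighbours c c'"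
  shows "c' \<in> ones F"
proof -
  obtain e where e: "e \<in> cell_edges c" "e \<in> cell_edges c'" and ne: "c \<noteq> c'"
    using nb by (auto simp: neighbours_def)
  have nin: "e \<notin> image_boundary F" using int e by blast
  have cc: "c \<in> image_cells F" using c by (simp add: ones_def)
  have "c' \<in> image_cells F"
  proof (rule ccontr)
    assume "c' \<notin> image_cells F"
    then have "{c'' \<in> image_cells F. e \<in> cell_edges c''} = {c}"
      using edge_at_most_two_cells[OF e _ ne] e cc by blast
    then show False using nin c by (auto simp: image_boundary_def)
  qed
  moreover have "c' \<notin> zeroes F"
    using nin c nb e by (auto simp: image_boundary_def)
  ultimately show ?thesis
    using F by (auto simp: is_binary_image_def ones_def zeroes_def)
qed

text \<open>\<open>steps_to_boundary F n c\<close>: the boundary can be reached from \<open>c\<close> in \<open>n\<close> steps between ones.\<close>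

fun steps_to_boundary :: "binary_image \<Rightarrow> nat \<Rightarrow> cell \<Rightarrow> bool" where
  "steps_to_boundary F 0 c \<longleftrightarrow> c \<in> ones F \<and> cell_edges c \<inter> image_boundary F \<noteq> {}"
| "steps_to_boundary F (Suc n) c \<longleftrightarrow>
     c \<in> ones F \<and> (\<exists>c'. neighbours c c' \<and> steps_to_boundary F n c')"

lemma steps_ones: "steps_to_boundary F n c \<Longrightarrow> c \<in> ones F"
  by (cases n) auto

lemma ex_steps_to_boundary:
  assumes F: "is_binary_image F"
  shows "c \<in> ones F \<Longrightarrow> \<exists>n. steps_to_boundary F n c"
proof (induction "nat (fst c - xmin F)" arbitrary: c rule: less_induct)
  case less
  show ?case
  proof (cases "cell_edges c \<inter> image_boundary F = {}")
    case False
    then have "steps_to_boundary F 0 c" using less.prems by simp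
    then show ?thesis ..
  next
    case True
    define c' where "c' = (fst c - 1, snd c)"
    have nb: "neighbours c c'"
      by (cases c) (simp add: c'_def neighbours_iff)
    have c': "c' \<in> ones F" using neighbours_of_interior[OF F less.prems True nb] .
    then have "nat (fst c' - xmin F) < nat (fst c - xmin F)"
      by (auto simp: c'_def ones_def image_cells_def)
    then obtain n where "steps_to_boundary F n c'" using less.hyps c' by blast
    then have "steps_to_boundary F (Suc n) c" using nb less.prems
      by (auto simp del: split_paired_Ex)
    then show ?thesis ..
  qed
qed

text \<open>The solution of the equations is the least number of such steps.\<close>

lemma distance_equations_solution:
  assumes F: "is_binary_image F"
  shows "distance_equations F
           (\<lambda>c. if c \<in> ones F then LEAST n. steps_to_boundary F n c else 0)"
    (is "distance_equations F ?d")
  unfolding distance_equations_def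
proof (intro conjI ballI allI impI)
  fix c assume c: "c \<in> ones F"
  show "?d c = (if cell_edges c \<inter> image_boundary F \<noteq> {} then 0
                else 1 + Min (?d ` {c'. neighbours c c'}))"
  proof (cases "cell_edges c \<inter> image_boundary F = {}")
    case False
    then have "steps_to_boundary F 0 c" using c by simp
    then have "(LEAST n. steps_to_boundary F n c) = 0" by (intro Least_equality) auto
    then show ?thesis using False c by simp
  next
    case True
    note nbs = neighbours_of_interior[OF F c True]
    have fin: "finite (?d ` {c'. neighbours c c'})" "?d ` {c'. neighbours c c'} \<noteq> {}"
      using neighbours_set[of c] by auto
    have reach: "steps_to_boundary F (?d c') c'" if "c' \<in> ones F" for c'
      using ex_steps_to_boundary[OF F that] that by (auto intro: LeastI)
    have "Min (?d ` {c'. neighbours c c'}) \<in> ?d ` {c'. neighbours c c'}"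
      using fin by (rule Min_in)
    then obtain c' where c': "neighbours c c'" "Min (?d ` {c'. neighbours c c'}) = ?d c'"
      by auto
    have "steps_to_boundary F (Suc (?d c')) c"
      using c c'(1) reach[OF nbs[OF c'(1)]] by (auto simp del: split_paired_Ex)
    then have "(LEAST n. steps_to_boundary F n c) = Suc (?d c')"
    proof (rule Least_equality)
      fix n assume n: "steps_to_boundary F n c"
      then obtain m where m: "n = Suc m" using True by (cases n) auto
      then obtain c'' where c'': "neighbours c c''" "steps_to_boundary F m c''" using n by auto
      then have "?d c'' \<le> m" using nbs by (auto intro: Least_le)
      moreover have "?d c' \<le> ?d c''"
        unfolding c'(2)[symmetric] using fin(1) c''(1) by (intro Min_le) auto
      ultimately show "Suc (?d c') \<le> n" using m by simp
    qed
    then show ?thesis using True c c'(2) by simp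
  qed
qed simp

lemma distance_equations_le_steps:
  assumes F: "is_binary_image F" and d: "distance_equations F d"
  shows "steps_to_boundary F n c \<Longrightarrow> d c \<le> n"
proof (induction n arbitrary: c)
  case 0
  then show ?case using d by (auto simp: distance_equations_def)
next
  case (Suc n)
  then obtain c' where c': "neighbours c c'" "steps_to_boundary F n c'" by auto
  have "Min (d ` {c'. neighbours c c'}) \<le> d c'"
    using neighbours_set[of c] c' by (intro Min_le) auto
  moreover have "d c \<le> 1 + Min (d ` {c'. neighbours c c'})"
    using d Suc.prems unfolding distance_equations_def by simp
  ultimately show ?case using Suc.IH[OF c'(2)] by linarith
qed

lemma distance_equations_steps:
  assumes F: "is_binary_image F" and d: "distance_equations F d"
  shows "c \<in> ones F \<Longrightarrow> steps_to_boundary F (d c) c"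
proof (induction "d c" arbitrary: c)
  case 0
  then have "cell_edges c \<inter> image_boundary F \<noteq> {}"
    using d unfolding distance_equations_def by (metis add_is_0 one_neq_zero)
  then show ?case using 0 by (metis steps_to_boundary.simps(1))
next
  case (Suc n)
  have eq: "d c = (if cell_edges c \<inter> image_boundary F \<noteq> {} then 0
               else 1 + Min (d ` {c'. neighbours c c'}))"
    using d Suc.prems unfolding distance_equations_def by blast
  then have int: "cell_edges c \<inter> image_boundary F = {}"
    using Suc.hyps(2) by (metis nat.distinct(1))
  have "Min (d ` {c'. neighbours c c'}) \<in> d ` {c'. neighbours c c'}"
    using neighbours_set[of c] by (intro Min_in) auto
  then obtain c' where c': "neighbours c c'" "d c = Suc (d c')" using eq int by auto
  then have "steps_to_boundary F (d c') c'"
    using Suc.hyps neighbours_of_interior[OF F Suc.prems int] by auto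
  then show ?case using c' Suc.prems by (metis steps_to_boundary.simps(2))
qed

lemma ex1_distance_equations:
  assumes F: "is_binary_image F"
  shows "\<exists>!d. distance_equations F d"
proof (rule ex_ex1I)
  show "\<exists>d. distance_equations F d" 
    using distance_equations_solution[OF F] by blast
next
  fix d d' assume d: "distance_equations F d" and d': "distance_equations F d'"
  show "d = d'"
  proof
    fix c
    show "d c = d' c"
    proof (cases "c \<in> ones F")
      case True
      then show ?thesis
        using distance_equations_steps[OF F d True] distance_equations_steps[OF F d' True]
          distance_equations_le_steps[OF F d] distance_equations_le_steps[OF F d']
        by (meson le_antisym)
    next
      case False
      then show ?thesis using d d' unfolding distance_equations_def by metis
    qed
  qed
qed

lemma boundary_distance_equations:
  "is_binary_image F \<Longrightarrow> distance_equations F (boundary_distance F)"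
  unfolding boundary_distance_def by (rule theI'[OF ex1_distance_equations])

lemma boundary_distance_eq_Least:
  assumes "is_binary_image F" "c \<in> ones F"
  shows "boundary_distance F c = (LEAST n. steps_to_boundary F n c)"
proof -
  have "boundary_distance F = (\<lambda>c. if c \<in> ones F then LEAST n. steps_to_boundary F n c else 0)"
    using distance_equations_solution[OF assms(1)]
    unfolding boundary_distance_def by (rule the1_equality[OF ex1_distance_equations[OF assms(1)]])
  then show ?thesis using assms(2) by simp
qed

lemma equiv_connected_ones: "equiv (ones F) (connected_ones F)"
proof (rule equivI)
  show "connected_ones F \<subseteq> ones F \<times> ones F"
  proof (rule subrelI)
    fix c c' assume "(c, c') \<in> connected_ones F"
    then obtain p where "p \<noteq> []" "hd p = c" "last p = c'" "set p \<subseteq> ones F"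
      by (auto simp: connected_ones_def cell_path_def)
    then show "(c, c') \<in> ones F \<times> ones F"
      using hd_in_set[of p] last_in_set[of p] by blast
  qed
  show "refl_on (ones F) (connected_ones F)"
  proof (rule refl_onI)
    fix c assume "c \<in> ones F"
    then have "cell_path [c] c c \<and> set [c] \<subseteq> ones F" by (simp add: cell_path_def)
    then show "(c, c) \<in> connected_ones F" unfolding connected_ones_def by blast
  qed
  show "sym (connected_ones F)"
  proof (rule symI)
    fix c c' assume "(c, c') \<in> connected_ones F"
    then obtain p where p: "cell_path p c c'" "set p \<subseteq> ones F"
      by (auto simp: connected_ones_def)
    have "successively neighbours (rev p)"
      using p(1) unfolding cell_path_def successively_rev
      by (metis (no_types, lifting) neighbours_sym successively_mono)
    then have "cell_path (rev p) c' c \<and> set (rev p) \<subseteq> ones F"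
      using p by (auto simp: cell_path_def hd_rev last_rev)
    then show "(c', c) \<in> connected_ones F" unfolding connected_ones_def by blast
  qed
  show "trans (connected_ones F)"
  proof (rule transI)
    fix a b c assume "(a, b) \<in> connected_ones F" "(b, c) \<in> connected_ones F"
    then obtain p q where p: "cell_path p a b" "set p \<subseteq> ones F"
      and q: "cell_path q b c" "set q \<subseteq> ones F"
      by (auto simp: connected_ones_def)
    obtain q' where q': "q = b # q'" using q(1) by (cases q) (auto simp: cell_path_def)
    have "cell_path (p @ q') a c \<and> set (p @ q') \<subseteq> ones F"
      using p q unfolding q'
      by (cases q') (auto simp: cell_path_def successively_append_iff)
    then show "(a, c) \<in> connected_ones F" unfolding connected_ones_def by blast
  qed
qed

end

theory Submission
  imports Defs "HOL-Library.Product_Plus"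
begin

text \<open>
  Passing from a set of cells to its interior (the cells all of whose neighbours belong to the set)
  discards the layer of distance \<open>0\<close>. This layer has fewer cells than there are boundary edges, so
  it suffices that the perimeter never grows when layers are peeled off: then \<open>k\<close> layers contain at
  most \<open>k (l - 1)\<close> cells.

  The perimeter is twice the number of horizontal and vertical runs. The number of vertical runs
  of \<open>Z\<close> exceeds that of \<open>{c \<in> Z. c + (1, 0) \<in> Z}\<close> by exactly the Euler characteristic of \<open>Z\<close>.
  After two such thinnings, the vertical runs of the result dominate those of the interior. So it is
  enough that the Euler characteristics of \<open>Z\<close> and of its first thinning are not negative.
  This follows from the inequality ``number of components \<open>\<le>\<close> Euler characteristic'', which
  survives the removal of any cell having a neighbour outside the set, by a comparison of the local
  changes of both sides. For a component without holes, such removals lead from the full rectangle to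
  the component; further such removals lead from the ones to all the thinned sets.
\<close>

section \<open>Euler characteristic and acyclic sets of cells\<close>

lemma neighbours_shift:
  "neighbours c c' \<longleftrightarrow> c' \<in> {c + (1, 0), c - (1, 0), c + (0, 1), c - (0, 1)}"
  by (cases c) (simp add: neighbours_iff)

text \<open>
  Cells minus adjacent pairs plus full \<open>2 \<times> 2\<close> blocks; a pair or block is counted at its lower
  left cell.
\<close>

definition euler :: "cell set \<Rightarrow> int" where
  "euler Z = (\<Sum>c\<in>Z. 1 - of_bool (c + (1, 0) \<in> Z) - of_bool (c + (0, 1) \<in> Z)
     + of_bool (c + (1, 0) \<in> Z \<and> c + (0, 1) \<in> Z \<and> c + (1, 1) \<in> Z))"

definition locally_constant :: "cell set \<Rightarrow> (cell \<Rightarrow> nat) \<Rightarrow> bool" where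
  "locally_constant Z f \<longleftrightarrow> (\<forall>c\<in>Z. \<forall>c'\<in>Z. neighbours c c' \<longrightarrow> f c = f c')"

text \<open>
  A locally constant function takes at most as many values as there are components, so this says
  that the number of components is at most the Euler characteristic.
\<close>

definition acyclic_cells :: "cell set \<Rightarrow> bool" where
  "acyclic_cells Z \<longleftrightarrow> (\<forall>f. locally_constant Z f \<longrightarrow> int (card (f ` Z)) \<le> euler Z)"

lemma acyclic_cells_euler_nonneg: "acyclic_cells Z \<Longrightarrow> 0 \<le> euler Z"
  by (force simp: acyclic_cells_def locally_constant_def dest: spec[of _ "\<lambda>_. 0"])

section \<open>Removal of a single cell\<close>

text \<open>The four \<open>2 x 2\<close> blocks around \<open>c\<close>, tested on their other
  three cells, so that removing \<open>c\<close> does not affect the count.\<close>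

definition squares_at :: "cell set \<Rightarrow> cell \<Rightarrow> int" where
  "squares_at Z c =
     of_bool (c + (1, 0) \<in> Z \<and> c + (0, 1) \<in> Z \<and> c + (1, 1) \<in> Z)
   + of_bool (c + (0, 1) \<in> Z \<and> c + (-1, 0) \<in> Z \<and> c + (-1, 1) \<in> Z)
   + of_bool (c + (-1, 0) \<in> Z \<and> c + (0, -1) \<in> Z \<and> c + (-1, -1) \<in> Z)
   + of_bool (c + (0, -1) \<in> Z \<and> c + (1, 0) \<in> Z \<and> c + (1, -1) \<in> Z)"

definition degree_at :: "cell set \<Rightarrow> cell \<Rightarrow> int" where
  "degree_at Z c = of_bool (c + (1, 0) \<in> Z) + of_bool (c + (0, 1) \<in> Z)
   + of_bool (c + (-1, 0) \<in> Z) + of_bool (c + (0, -1) \<in> Z)"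

text \<open>Cells, adjacent pairs and blocks containing \<open>c\<close> disappear; they enter
  \<open>euler\<close> with signs plus, minus and plus.\<close>

lemma euler_remove:
  assumes "finite Z" "c \<in> Z"
  shows "euler (Z - {c}) = euler Z + degree_at Z c - squares_at Z c - 1"
proof -
  obtain x y where c: "c = (x, y)" by (cases c)
  define w where "w Y d = 1 - of_bool (d + (1, 0) \<in> Y) - of_bool (d + (0, 1) \<in> Y)
     + (of_bool (d + (1, 0) \<in> Y \<and> d + (0, 1) \<in> Y \<and> d + (1, 1) \<in> Y) :: int)"
    for Y :: "cell set" and d
  define S where "S Y = (\<Sum>d\<in>Z - {c}. w Y d)" for Y
  \<comment> \<open>Pairs and blocks are booked at their lower left cell, so besides
    \<open>c\<close> itself only these three cells have a summand that looks at
    \<open>c\<close>.\<close>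
  define D where "D = {(x - 1, y), (x, y - 1), (x - 1, y - 1)}"
  have "euler Z = w Z c + S Z"
    unfolding euler_def S_def w_def using assms by (subst sum.remove[of Z c]) auto
  moreover have "euler (Z - {c}) = S (Z - {c})"
    unfolding euler_def S_def w_def ..
  moreover have "S (Z - {c}) - S Z = (\<Sum>d\<in>D. of_bool (d \<in> Z) * (w (Z - {c}) d - w Z d))"
  proof -
    have "S (Z - {c}) - S Z = (\<Sum>d\<in>Z - {c}. w (Z - {c}) d - w Z d)"
      by (simp add: S_def sum_subtractf)
    also have "\<dots> = (\<Sum>d\<in>D \<inter> Z. w (Z - {c}) d - w Z d)"
      using assms(1) by (intro sum.mono_neutral_right) (auto simp: D_def c w_def)
    also have "\<dots> = (\<Sum>d\<in>D. of_bool (d \<in> Z) * (w (Z - {c}) d - w Z d))"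
      by (rule sum.mono_neutral_cong_left) (auto simp: D_def)
    finally show ?thesis .
  qed
  moreover have "(\<Sum>d\<in>D. of_bool (d \<in> Z) * (w (Z - {c}) d - w Z d)) - w Z c
      = degree_at Z c - squares_at Z c - 1"
    using assms(2) by (simp add: D_def c w_def degree_at_def squares_at_def of_bool_conj)
  ultimately show ?thesis by simp
qed

text \<open>
  A missing neighbour cuts the cycle of the four neighbours open into the path \<open>n1\<close>, \<open>n2\<close>, \<open>n3\<close>.
\<close>

lemma card_image_path_le:
  fixes f :: "'a \<Rightarrow> 'b"
  assumes "p12 \<Longrightarrow> n1 \<in> Z \<and> n2 \<in> Z \<and> f n2 = f n1" "p23 \<Longrightarrow> n2 \<in> Z \<and> n3 \<in> Z \<and> f n3 = f n2"
  shows "int (card (f ` (Z \<inter> {n1, n2, n3}))) \<le> of_bool (n1 \<in> Z) + of_bool (n2 \<in> Z)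
    + of_bool (n3 \<in> Z) - of_bool p12 - of_bool p23"
proof -
  \<comment> \<open>A cell contributes a value of its own only if no link identifies it with its
    predecessor on the path.\<close>
  define A where "A = (if n1 \<in> Z then {f n1} else {})"
  define B where "B = (if n2 \<in> Z \<and> \<not> p12 then {f n2} else {})"
  define C where "C = (if n3 \<in> Z \<and> \<not> p23 then {f n3} else {})"
  have "f ` (Z \<inter> {n1, n2, n3}) \<subseteq> A \<union> B \<union> C"
    using assms unfolding A_def B_def C_def by auto
  then have "card (f ` (Z \<inter> {n1, n2, n3})) \<le> card (A \<union> B \<union> C)"
    by (rule card_mono[rotated]) (auto simp: A_def B_def C_def)
  also have "\<dots> \<le> card A + card B + card C"
    by (metis add_le_mono1 card_Un_le order_trans)
  finally show ?thesis using assms by (auto simp: A_def B_def C_def split: if_splits)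
qed

text \<open>Each full block at \<open>c\<close> links two neighbours of \<open>c\<close> through its
  diagonal cell and so saves one value. The links form a path since \<open>n\<close> is missing; a
  closed cycle of four links would make the right side \<open>0\<close>.\<close>

lemma card_neighbour_values_le:
  assumes f: "locally_constant (Z - {c}) f" and n: "neighbours c n" "n \<notin> Z"
  shows "int (card (f ` {c' \<in> Z. neighbours c c'})) \<le> degree_at Z c - squares_at Z c"
proof -
  obtain x y where c: "c = (x, y)" by (cases c)
  have sq: "f (x + a, y) = f (x, y + b)"
    if "(x + a, y) \<in> Z" "(x, y + b) \<in> Z" "(x + a, y + b) \<in> Z" "a \<in> {1, -1}" "b \<in> {1, -1}" for a b
  proof -
    have "f (x + a, y) = f (x + a, y + b)" "f (x, y + b) = f (x + a, y + b)"
      using f that unfolding locally_constant_def c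
      by (auto simp: neighbours_iff simp del: split_paired_All split_paired_Ball_Sigma)
    then show ?thesis by simp
  qed
  note sq = sq[of 1 1, simplified] sq[of 1 "-1", simplified] sq[of "-1" 1, simplified] sq[of "-1" "-1", simplified]
  have nb: "{c' \<in> Z. neighbours c c'} = Z \<inter> {(x + 1, y), (x, y + 1), (x - 1, y), (x, y - 1)}"
    unfolding c by (auto simp: neighbours_iff)
  consider "(x + 1, y) \<notin> Z" | "(x, y + 1) \<notin> Z" | "(x - 1, y) \<notin> Z" | "(x, y - 1) \<notin> Z"
    using n unfolding c neighbours_iff by auto
  then show ?thesis
  proof cases
    case 1
    then have "{c' \<in> Z. neighbours c c'} = Z \<inter> {(x, y + 1), (x - 1, y), (x, y - 1)}"
      unfolding nb by auto
    then show ?thesis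
      using card_image_path_le[of "(x, y + 1) \<in> Z \<and> (x - 1, y) \<in> Z \<and> (x - 1, y + 1) \<in> Z"
          "(x, y + 1)" Z "(x - 1, y)" f "(x - 1, y) \<in> Z \<and> (x, y - 1) \<in> Z \<and> (x - 1, y - 1) \<in> Z" "(x, y - 1)"] 1 sq
      by (simp add: c degree_at_def squares_at_def)
  next
    case 2
    then have "{c' \<in> Z. neighbours c c'} = Z \<inter> {(x - 1, y), (x, y - 1), (x + 1, y)}"
      unfolding nb by auto
    then show ?thesis
      using card_image_path_le[of "(x - 1, y) \<in> Z \<and> (x, y - 1) \<in> Z \<and> (x - 1, y - 1) \<in> Z"
          "(x - 1, y)" Z "(x, y - 1)" f "(x, y - 1) \<in> Z \<and> (x + 1, y) \<in> Z \<and> (x + 1, y - 1) \<in> Z" "(x + 1, y)"] 2 sq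
      by (simp add: c degree_at_def squares_at_def)
  next
    case 3
    then have "{c' \<in> Z. neighbours c c'} = Z \<inter> {(x, y - 1), (x + 1, y), (x, y + 1)}"
      unfolding nb by auto
    then show ?thesis
      using card_image_path_le[of "(x, y - 1) \<in> Z \<and> (x + 1, y) \<in> Z \<and> (x + 1, y - 1) \<in> Z"
          "(x, y - 1)" Z "(x + 1, y)" f "(x + 1, y) \<in> Z \<and> (x, y + 1) \<in> Z \<and> (x + 1, y + 1) \<in> Z" "(x, y + 1)"] 3 sq
      by (simp add: c degree_at_def squares_at_def)
  next
    case 4
    then have "{c' \<in> Z. neighbours c c'} = Z \<inter> {(x + 1, y), (x, y + 1), (x - 1, y)}"
      unfolding nb by auto
    then show ?thesis
      using card_image_path_le[of "(x + 1, y) \<in> Z \<and> (x, y + 1) \<in> Z \<and> (x + 1, y + 1) \<in> Z"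
          "(x + 1, y)" Z "(x, y + 1)" f "(x, y + 1) \<in> Z \<and> (x - 1, y) \<in> Z \<and> (x - 1, y + 1) \<in> Z" "(x - 1, y)"] 4 sq
      by (simp add: c degree_at_def squares_at_def)
  qed
qed

text \<open>Restoring \<open>c\<close> merges the values in \<open>M\<close> into one. This changes
  the number of values by \<open>1 - card M\<close>, while removing \<open>c\<close> changes
  \<open>euler\<close> by at least \<open>card M - 1\<close>.\<close>

lemma acyclic_cells_remove:
  assumes fin: "finite Z" and Z: "acyclic_cells Z" and c: "c \<in> Z" "neighbours c n" "n \<notin> Z"
  shows "acyclic_cells (Z - {c})"
  unfolding acyclic_cells_def
proof (intro allI impI)
  fix f assume f: "locally_constant (Z - {c}) f"
  define V where "V = f ` (Z - {c})"
  define M where "M = f ` {c' \<in> Z. neighbours c c'}"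
  have ncc: "\<not> neighbours c c" by (simp add: neighbours_def)
  have MV: "M \<subseteq> V" using ncc by (auto simp: M_def V_def)
  have finV: "finite V" using fin by (simp add: V_def)
  obtain m where m: "m \<notin> V - M" "M \<noteq> {} \<Longrightarrow> m \<in> M"
    using ex_new_if_finite[OF infinite_UNIV_nat finV] by (cases "M = {}") auto
  \<comment> \<open>Merging the values around \<open>c\<close> (or taking a fresh one, if \<open>c\<close> is isolated) extends \<open>f\<close> to \<open>c\<close>.\<close>
  define g where "g d = (if d = c \<or> f d \<in> M then m else f d)" for d
  have g: "locally_constant Z g"
    unfolding locally_constant_def
  proof (intro ballI impI)
    fix a b assume ab: "a \<in> Z" "b \<in> Z" "neighbours a b"
    consider "a = c" | "b = c" | "a \<noteq> c" "b \<noteq> c" by blast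
    then show "g a = g b"
    proof cases
      case 1 then show ?thesis using ab by (auto simp: g_def M_def)
    next
      case 2 then show ?thesis using ab neighbours_sym[OF ab(3)] by (auto simp: g_def M_def)
    next
      case 3 then have "f a = f b" using f ab unfolding locally_constant_def by blast
      then show ?thesis using 3 by (simp add: g_def)
    qed
  qed
  have "g ` Z = insert m (V - M)"
    using c(1) m(2) by (auto simp: g_def V_def image_iff)
  then have "card (g ` Z) = card V - card M + 1"
    using m(1) finV MV by (simp add: card_Diff_subset finite_subset)
  moreover have "card M \<le> card V" using MV finV by (rule card_mono[rotated])
  moreover have "int (card (g ` Z)) \<le> euler Z" using Z g by (simp add: acyclic_cells_def)
  moreover have "int (card M) \<le> degree_at Z c - squares_at Z c"
    unfolding M_def by (rule card_neighbour_values_le[OF f c(2,3)])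
  ultimately show "int (card (f ` (Z - {c}))) \<le> euler (Z - {c})"
    using euler_remove[OF fin c(1)] by (simp add: V_def of_nat_diff)
qed

section \<open>Peeling, rectangles and separated unions\<close>

text \<open>The last assumption says that a greedy removal of exposed cells never gets stuck before
  reaching \<open>K\<close>.\<close>

lemma acyclic_cells_peel:
  assumes "finite Z" "acyclic_cells Z" "K \<subseteq> Z"
    and "\<And>Y. K \<subset> Y \<Longrightarrow> Y \<subseteq> Z \<Longrightarrow> \<exists>c\<in>Y - K. \<exists>n. neighbours c n \<and> n \<notin> Y"
  shows "acyclic_cells K"
  using assms
proof (induction "card Z" arbitrary: Z rule: less_induct)
  case less
  show ?case
  proof (cases "K = Z")
    case False
    then obtain c n where c: "c \<in> Z - K" "neighbours c n" "n \<notin> Z"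
      using less.prems(3,4) by blast
    have "acyclic_cells (Z - {c})"
      using acyclic_cells_remove[of Z c n] less.prems(1,2) c by blast
    moreover have "card (Z - {c}) < card Z" using c(1) less.prems(1) by (intro card_Diff1_less) auto
    moreover have "finite (Z - {c})" "K \<subseteq> Z - {c}" using less.prems(1,3) c(1) by auto
    ultimately show ?thesis
      using less.hyps less.prems(4) by (meson Diff_subset order_trans)
  qed (use less in simp)
qed

text \<open>A neighbour missing from \<open>Z\<close> is missing from every subset, so the cells can
  be removed in any order.\<close>

lemma acyclic_cells_erode:
  assumes "finite Z" "acyclic_cells Z" "K \<subseteq> Z"
    and "\<And>c. c \<in> Z - K \<Longrightarrow> \<exists>n. neighbours c n \<and> n \<notin> Z"
  shows "acyclic_cells K"
proof (rule acyclic_cells_peel[OF assms(1-3)])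
  fix Y assume "K \<subset> Y" "Y \<subseteq> Z"
  then show "\<exists>c\<in>Y - K. \<exists>n. neighbours c n \<and> n \<notin> Y" using assms(4) by blast
qed

lemma acyclic_cells_rectangle:
  fixes a b a' b' :: int
  assumes "a < a'" "b < b'"
  shows "acyclic_cells ({a..<a'} \<times> {b..<b'})"
  unfolding acyclic_cells_def
proof (intro allI impI)
  let ?R = "{a..<a'} \<times> {b..<b'}"
  fix f assume f: "locally_constant ?R f"
  \<comment> \<open>The summands are \<open>1 - 1 - 1 + 1\<close> inside and \<open>1 - 1\<close> on
    the last row and column; only the upper right corner keeps its \<open>1\<close>.\<close>
  have "euler ?R = (\<Sum>c\<in>?R. if c = (a' - 1, b' - 1) then 1 else 0)"
    unfolding euler_def by (rule sum.cong) auto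
  also have "\<dots> = 1" using assms by (subst sum.delta) auto
  finally have "euler ?R = 1" .
  moreover have row: "f (x, y) = f (a, y)" if "b \<le> y" "y < b'" "a \<le> x" "x < a'" for x y
    using that(3,4)
  proof (induction x rule: int_ge_induct)
    case (step i)
    have "f (i + 1, y) = f (i, y)"
      by (rule f[unfolded locally_constant_def, rule_format])
        (use step that(1,2) in \<open>auto simp: neighbours_iff\<close>)
    then show ?case using step by simp
  qed simp
  moreover have col: "f (a, y) = f (a, b)" if "b \<le> y" "y < b'" for y
    using that
  proof (induction y rule: int_ge_induct)
    case (step i)
    have "f (a, i + 1) = f (a, i)"
      by (rule f[unfolded locally_constant_def, rule_format])
        (use step assms in \<open>auto simp: neighbours_iff\<close>)
    then show ?case using step by simp
  qed simp
  have "f ` ?R \<subseteq> {f (a, b)}"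
  proof (rule image_subsetI)
    fix c assume "c \<in> ?R"
    then show "f c \<in> {f (a, b)}"
      using row[of "snd c" "fst c"] col[of "snd c"] by (cases c) auto
  qed
  then have "card (f ` ?R) \<le> 1" using card_mono[of "{f (a, b)}" "f ` ?R"] by simp
  ultimately show "int (card (f ` ?R)) \<le> euler ?R" by simp
qed

text \<open>No pair or block straddles two separated pieces, so \<open>euler\<close> is additive,
  whereas the number of values is subadditive.\<close>

lemma acyclic_cells_Union:
  assumes fin: "finite (\<Union>\<K>)" and disj: "pairwise disjnt \<K>"
    and ac: "\<And>K. K \<in> \<K> \<Longrightarrow> acyclic_cells K"
    and sep: "\<And>K c c'. K \<in> \<K> \<Longrightarrow> c \<in> K \<Longrightarrow> c' \<in> \<Union>\<K> \<Longrightarrow> neighbours c c' \<Longrightarrow> c' \<in> K"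
  shows "acyclic_cells (\<Union>\<K>)"
proof -
  let ?U = "\<Union>\<K>"
  have finK: "finite \<K>" "\<And>K. K \<in> \<K> \<Longrightarrow> finite K"
    using fin finite_UnionD by (auto intro: finite_subset)
  have "euler ?U = (\<Sum>K\<in>\<K>. euler K)"
    unfolding euler_def
    using disj finK
  proof (subst sum.Union_disjoint, goal_cases)
    case 3
    show ?case unfolding o_apply
    proof (intro sum.cong refl)
      fix K c assume K: "K \<in> \<K>" and c: "c \<in> K"
      have E: "d + (1, 0) \<in> ?U \<longleftrightarrow> d + (1, 0) \<in> K" and N: "d + (0, 1) \<in> ?U \<longleftrightarrow> d + (0, 1) \<in> K"
        if "d \<in> K" for d
        using sep[OF K that, of "d + (1, 0)"] sep[OF K that, of "d + (0, 1)"] K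
        by (auto simp: neighbours_shift)
      \<comment> \<open>The diagonal cell is no neighbour of \<open>c\<close>; it is reached through
        \<open>c + (1, 0)\<close>.\<close>
      have "c + (1, 1) \<in> ?U \<longleftrightarrow> c + (1, 1) \<in> K" if "c + (1, 0) \<in> K"
        using N[OF that] by (simp add: add.assoc)
      then show "1 - of_bool (c + (1, 0) \<in> ?U) - of_bool (c + (0, 1) \<in> ?U) +
            of_bool (c + (1, 0) \<in> ?U \<and> c + (0, 1) \<in> ?U \<and> c + (1, 1) \<in> ?U)
         = 1 - of_bool (c + (1, 0) \<in> K) - of_bool (c + (0, 1) \<in> K) +
            (of_bool (c + (1, 0) \<in> K \<and> c + (0, 1) \<in> K \<and> c + (1, 1) \<in> K) :: int)"
        using E[OF c] N[OF c] by (simp cong: conj_cong del: Union_iff)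
    qed
  qed (auto simp: pairwise_def disjnt_def)
  moreover have "int (card (f ` ?U)) \<le> (\<Sum>K\<in>\<K>. euler K)" if f: "locally_constant ?U f" for f
  proof -
    have "card (f ` ?U) \<le> (\<Sum>K\<in>\<K>. card (f ` K))"
      unfolding image_Union using finK(1) by (rule card_UN_le)
    then have "int (card (f ` ?U)) \<le> (\<Sum>K\<in>\<K>. int (card (f ` K)))" by (simp flip: of_nat_sum)
    also have "\<dots> \<le> (\<Sum>K\<in>\<K>. euler K)"
      using f ac by (intro sum_mono) (auto simp: acyclic_cells_def locally_constant_def)
    finally show ?thesis .
  qed
  ultimately show ?thesis by (simp add: acyclic_cells_def)
qed

section \<open>Components without holes\<close>

lemma finite_ones: "finite (ones F)"
  by (rule finite_subset[of _ "image_cells F"]) (auto simp: ones_def image_cells_def)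

lemma neighbours_connected_ones:
  assumes "c \<in> ones F" "c' \<in> ones F" "neighbours c c'"
  shows "(c, c') \<in> connected_ones F"
proof -
  have "cell_path [c, c'] c c' \<and> set [c, c'] \<subseteq> ones F" using assms by (simp add: cell_path_def)
  then show ?thesis unfolding connected_ones_def by blast
qed

lemma image_component_closed:
  assumes "K \<in> image_components F" "c \<in> K" "c' \<in> ones F" "neighbours c c'"
  shows "c' \<in> K"
proof -
  have "c \<in> ones F"
    using assms(1,2) Union_quotient[OF equiv_connected_ones[of F]] by (auto simp: image_components_def)
  then have "(c, c') \<in> connected_ones F" using neighbours_connected_ones assms(3,4) by blast
  then show ?thesis
    using assms(1,2) in_quotient_imp_closed[OF equiv_connected_ones] unfolding image_components_def by blast
qed

lemma cell_path_stays:
  assumes "cell_path p c c'" "c \<in> W"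
    and "\<And>d e. d \<in> W \<Longrightarrow> neighbours d e \<Longrightarrow> e \<in> set p \<Longrightarrow> e \<in> W"
  shows "c' \<in> W"
  using assms
proof (induction p arbitrary: c)
  case (Cons a p)
  show ?case
  proof (cases p)
    case Nil
    then show ?thesis using Cons.prems by (auto simp: cell_path_def)
  next
    case (Cons b q)
    then have p: "cell_path p b c'" "neighbours a b" "a = c"
      using Cons.prems(1) by (auto simp: cell_path_def)
    have "b \<in> W" using Cons.prems(2,3) p(2,3) Cons by simp
    then show ?thesis
      by (rule Cons.IH[OF p(1)]) (use Cons.prems(3) in simp)
  qed
qed (simp add: cell_path_def)

text \<open>The full rectangle is peeled down to \<open>K\<close>. If this got stuck at
  \<open>Y\<close>, all neighbours of cells in \<open>Y - K\<close> would lie in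
  \<open>Y\<close>.\<close>

lemma acyclic_image_component:
  assumes F: "is_binary_image F" and K: "K \<in> image_components F" and hole: "\<not> has_hole F K"
  shows "acyclic_cells K"
proof (rule acyclic_cells_peel)
  show "finite (image_cells F)" by (simp add: image_cells_def)
  show "acyclic_cells (image_cells F)"
    unfolding image_cells_def using F by (intro acyclic_cells_rectangle) (auto simp: is_binary_image_def)
  have K1: "K \<subseteq> ones F"
    using K Union_quotient[OF equiv_connected_ones[of F]] by (auto simp: image_components_def)
  then show "K \<subseteq> image_cells F" by (auto simp: ones_def)
  fix Y assume Y: "K \<subset> Y" "Y \<subseteq> image_cells F"
  show "\<exists>c\<in>Y - K. \<exists>n. neighbours c n \<and> n \<notin> Y"
  proof (rule ccontr)
    assume "\<not> ?thesis"
    then have nb: "n \<in> Y" if "c \<in> Y - K" "neighbours c n" for c n using that by blast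
    show False
    proof (cases "\<exists>z. z \<in> Y - K \<and> z \<in> zeroes F")
      case True
      then obtain z where z: "z \<in> Y - K" "z \<in> zeroes F" by blast
      then obtain c p where p: "c \<notin> image_cells F" "cell_path p z c" "set p \<inter> K = {}"
        using hole unfolding has_hole_def by blast
      have "c \<in> Y - K"
        \<comment> \<open>A path avoiding \<open>K\<close> cannot leave \<open>Y - K\<close>,
          although it ends outside the rectangle.\<close>
        by (rule cell_path_stays[OF p(2) z(1)]) (use nb p(3) in blast)
      then show False using p(1) Y by blast
    next
      case False
      then have one: "Y - K \<subseteq> ones F"
        using F Y unfolding is_binary_image_def ones_def zeroes_def by blast
      have fin: "finite (Y - K)" "Y - K \<noteq> {}"
        using one finite_ones[of F] Y(1) by (auto intro: finite_subset)
      \<comment> \<open>The right neighbour of a rightmost cell of \<open>Y - K\<close> lies in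
        \<open>Y\<close>, hence in \<open>K\<close>; then the component \<open>K\<close> would
        absorb that cell.\<close>
      obtain c where c: "c \<in> Y - K" "\<And>d. d \<in> Y - K \<Longrightarrow> fst d \<le> fst c"
        using fin Max_in[of "fst ` (Y - K)"] Max_ge[of "fst ` (Y - K)"] by fastforce
      have n: "neighbours c (c + (1, 0))" by (simp add: neighbours_shift)
      have "c + (1, 0) \<in> K" using nb[OF c(1) n] c(2)[of "c + (1, 0)"] by auto
      then show False
        using image_component_closed[OF K _ _ neighbours_sym[OF n]] c(1) one by blast
    qed
  qed
qed

lemma acyclic_ones:
  assumes "is_binary_image F" "\<forall>K\<in>image_components F. \<not> has_hole F K"
  shows "acyclic_cells (ones F)"
proof -
  have U: "\<Union>(image_components F) = ones F"
    unfolding image_components_def by (rule Union_quotient[OF equiv_connected_ones])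
  have "acyclic_cells (\<Union>(image_components F))"
  proof (rule acyclic_cells_Union)
    show "pairwise disjnt (image_components F)"
      using quotient_disj[OF equiv_connected_ones[of F]]
      by (auto simp: pairwise_def disjnt_def image_components_def)
  qed (use assms acyclic_image_component image_component_closed U finite_ones in auto)
  then show ?thesis by (simp add: U)
qed

section \<open>Runs and perimeter of the interior\<close>

text \<open>Runs in direction \<open>v\<close> are counted by their last cells.\<close>

definition runs :: "cell \<Rightarrow> cell set \<Rightarrow> nat" where
  "runs v Z = card {c \<in> Z. c + v \<notin> Z}"

definition interior_cells :: "cell set \<Rightarrow> cell set" where
  "interior_cells Z = {c \<in> Z. \<forall>c'. neighbours c c' \<longrightarrow> c' \<in> Z}"

lemma acyclic_interior_cells:
  "finite Z \<Longrightarrow> acyclic_cells Z \<Longrightarrow> acyclic_cells (interior_cells Z)"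
  by (rule acyclic_cells_erode) (auto simp: interior_cells_def)

text \<open>The identity holds cell by cell: if \<open>a\<close>, \<open>b\<close>, \<open>d\<close>
  indicate that \<open>c + u\<close>, \<open>c + v\<close>, \<open>c + u + v\<close> lie in
  \<open>Z\<close>, it reads \<open>1 - b = (a - a b d) + (1 - a - b + a b d)\<close>.\<close>

lemma runs_euler:
  fixes u v :: cell
  assumes fin: "finite Z" and uv: "(u, v) \<in> {((1, 0), (0, 1)), ((0, 1), (1, 0))}"
  shows "int (runs v Z) = int (runs v {c \<in> Z. c + u \<in> Z}) + euler Z"
proof -
  let ?Y = "{c \<in> Z. c + u \<in> Z}"
  have runs: "int (runs v Y) = (\<Sum>c\<in>Z. of_bool (c \<in> Y \<and> c + v \<notin> Y))" if "Y \<subseteq> Z" for Y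
  proof -
    have "{c \<in> Y. c + v \<notin> Y} = Z \<inter> {c. c \<in> Y \<and> c + v \<notin> Y}" using that by blast
    then show ?thesis using fin by (simp add: runs_def sum_of_bool_eq)
  qed
  show ?thesis
    unfolding runs[OF subset_refl] runs[of ?Y, OF Collect_restrict] euler_def sum.distrib[symmetric]
    using uv by (intro sum.cong) (auto simp: add.assoc)
qed

lemma runs_interior_cells_le:
  fixes u v :: cell
  assumes fin: "finite Z" and ac: "acyclic_cells Z"
    and uv: "(u, v) \<in> {((1, 0), (0, 1)), ((0, 1), (1, 0))}"
  shows "runs v (interior_cells Z) \<le> runs v Z"
proof -
  define Y where "Y = {c \<in> Z. c + u \<in> Z}"
  define A where "A = {c \<in> Y. c + u \<in> Y}"
  have "neighbours c (c + u)" for c using uv by (auto simp: neighbours_shift)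
  then have acY: "acyclic_cells Y"
    by (intro acyclic_cells_erode[OF fin ac]) (unfold Y_def, blast+)
  have finY: "finite Y" using fin by (simp add: Y_def)
  \<comment> \<open>
    If \<open>c\<close> ends a run of the interior while \<open>c + v\<close> still is the middle of a triple in direction \<open>u\<close>,
    then \<open>c + v + v \<notin> Z\<close>, so that the run of triples ends at \<open>c + v\<close>. An element of \<open>A\<close> is the
    first cell of its triple, whence the shift by \<open>u\<close>.\<close>
  define h where "h c = (if c + v - u \<in> A then c + v - u else c - u)" for c
  have int: "c \<in> interior_cells Z \<longleftrightarrow> c \<in> Z \<and> c + u \<in> Z \<and> c - u \<in> Z \<and> c + v \<in> Z \<and> c - v \<in> Z" for c
    using uv by (auto simp: interior_cells_def neighbours_shift simp del: split_paired_All)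
  have A: "c - u \<in> A \<longleftrightarrow> c \<in> Z \<and> c + u \<in> Z \<and> c - u \<in> Z" for c
    by (auto simp: A_def Y_def)
  have "runs v (interior_cells Z) \<le> runs v A"
    unfolding runs_def
  proof (rule card_inj_on_le)
    show "finite {c \<in> A. c + v \<notin> A}" using finY by (simp add: A_def)
    show "h ` {c \<in> interior_cells Z. c + v \<notin> interior_cells Z} \<subseteq> {c \<in> A. c + v \<notin> A}"
    proof (rule image_subsetI)
      fix c assume c: "c \<in> {c \<in> interior_cells Z. c + v \<notin> interior_cells Z}"
      have shift: "c + v - u + v = c + v + v - u" "c - u + v = c + v - u"
        by (simp_all add: algebra_simps)
      show "h c \<in> {c \<in> A. c + v \<notin> A}"
      proof (cases "c + v - u \<in> A")
        case True
        then have "c + v + v \<notin> Z" using c by (auto simp: A int)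
        then have "c + v + v - u \<notin> A" by (simp add: A)
        then show ?thesis using True by (simp add: h_def shift)
      next
        case False
        have "c - u \<in> A" using c by (simp add: A int)
        then show ?thesis using False by (simp add: h_def shift)
      qed
    qed
    show "inj_on h {c \<in> interior_cells Z. c + v \<notin> interior_cells Z}"
    proof (rule inj_onI)
      fix c d
      assume "c \<in> {c \<in> interior_cells Z. c + v \<notin> interior_cells Z}"
        and "d \<in> {c \<in> interior_cells Z. c + v \<notin> interior_cells Z}"
      \<comment> \<open>Equal images force \<open>c\<close> and \<open>d\<close> to differ by
        \<open>0\<close> or by \<open>v\<close> up to sign; the latter is impossible for two last
        cells of runs.\<close>
      then have "c \<noteq> d + v" "d \<noteq> c + v" by blast+
      moreover assume "h c = h d"
      ultimately show "c = d" by (simp add: h_def split: if_splits)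
    qed
  qed
  also have "runs v A \<le> runs v Y"
    using runs_euler[OF finY uv] acyclic_cells_euler_nonneg[OF acY] by (simp add: A_def)
  also have "runs v Y \<le> runs v Z"
    using runs_euler[OF fin uv] acyclic_cells_euler_nonneg[OF ac] by (simp add: Y_def)
  finally show ?thesis .
qed

definition perimeter :: "cell set \<Rightarrow> nat" where
  "perimeter Z = 2 * (runs (1, 0) Z + runs (0, 1) Z)"

lemma perimeter_interior_cells_le:
  "finite Z \<Longrightarrow> acyclic_cells Z \<Longrightarrow> perimeter (interior_cells Z) \<le> perimeter Z"
  unfolding perimeter_def
  using runs_interior_cells_le[of Z "(1, 0)" "(0, 1)"] runs_interior_cells_le[of Z "(0, 1)" "(1, 0)"]
  by simp

text \<open>Translation by \<open>v\<close> matches the cells having a predecessor with those having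
  a successor; first and last cells of runs are the complements.\<close>

lemma runs_uminus:
  assumes "finite Z"
  shows "card {c \<in> Z. c - v \<notin> Z} = runs v Z"
proof -
  have "card {c \<in> Z. c - v \<in> Z} = card {c \<in> Z. c + v \<in> Z}"
    by (rule bij_betw_same_card[of "\<lambda>c. c - v"])
      (rule bij_betw_byWitness[where f' = "\<lambda>c. c + v"], auto)
  moreover have "card {c \<in> Z. c - v \<in> Z} + card {c \<in> Z. c - v \<notin> Z} = card Z"
    using assms by (subst card_Un_disjoint[symmetric]) (auto intro: arg_cong[where f = card])
  moreover have "card {c \<in> Z. c + v \<in> Z} + card {c \<in> Z. c + v \<notin> Z} = card Z"
    using assms by (subst card_Un_disjoint[symmetric]) (auto intro: arg_cong[where f = card])
  ultimately show ?thesis unfolding runs_def by linarith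
qed

section \<open>Counting cells by layers\<close>

lemma card_layer_less_perimeter:
  assumes fin: "finite Z" and ne: "Z \<noteq> {}"
  shows "card (Z - interior_cells Z) < perimeter Z"
proof -
  define A where "A = {c \<in> Z. c + (1, 0) \<notin> Z}"
  define B where "B = {c \<in> Z. c + (0, 1) \<notin> Z}"
  define A' where "A' = {c \<in> Z. c - (1, 0) \<notin> Z}"
  define B' where "B' = {c \<in> Z. c - (0, 1) \<notin> Z}"
  have f: "finite A" "finite B" "finite A'" "finite B'"
    using fin by (auto simp: A_def B_def A'_def B'_def)
  \<comment> \<open>A cell with maximal coordinate sum ends both a horizontal and a vertical run. It
    is counted twice, which makes the inequality strict.\<close>
  obtain c where c: "c \<in> Z" "\<And>d. d \<in> Z \<Longrightarrow> fst d + snd d \<le> fst c + snd c"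
    using fin ne Max_in[of "(\<lambda>c. fst c + snd c) ` Z"] Max_ge[of "(\<lambda>c. fst c + snd c) ` Z"] by fastforce
  have "c \<in> A \<inter> B"
    using c(1) c(2)[of "c + (1, 0)"] c(2)[of "c + (0, 1)"] by (auto simp: A_def B_def)
  then have "card (A \<inter> B) > 0" using f by (auto simp: card_gt_0_iff)
  then have AB: "card (A \<union> B) < card A + card B" using card_Un_Int[OF f(1,2)] by linarith
  have "card (Z - interior_cells Z) \<le> card (A \<union> B \<union> (A' \<union> B'))"
    using f by (intro card_mono)
      (auto simp: A_def B_def A'_def B'_def interior_cells_def neighbours_shift)
  also have "\<dots> \<le> card (A \<union> B) + (card A' + card B')"
    by (meson add_left_mono card_Un_le order_trans)
  also have "\<dots> < card A + card B + (card A' + card B')" using AB by simp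
  also have "\<dots> = perimeter Z"
    using runs_uminus[OF fin, of "(1, 0)"] runs_uminus[OF fin, of "(0, 1)"]
    by (simp add: perimeter_def A'_def B'_def A_def B_def runs_def)
  finally show ?thesis .
qed

text \<open>As a mere upper bound for the perimeter, \<open>l\<close> stays fixed while the set
  shrinks; each layer has at most \<open>l - 1\<close> cells.\<close>

lemma card_less_layers:
  assumes "finite Z" "acyclic_cells Z" "perimeter Z \<le> l" "l > 0" "(interior_cells ^^ k) Z = {}"
  shows "card Z \<le> k * (l - 1)"
  using assms
proof (induction k arbitrary: Z)
  case (Suc k)
  let ?I = "interior_cells Z"
  have I: "?I \<subseteq> Z" by (auto simp: interior_cells_def)
  have "card ?I \<le> k * (l - 1)"
    using Suc.prems I by (intro Suc.IH acyclic_interior_cells)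
      (auto intro: finite_subset order_trans[OF perimeter_interior_cells_le] simp: funpow_Suc_right simp del: funpow.simps)
  moreover have "card (Z - ?I) \<le> l - 1"
    using card_layer_less_perimeter[of Z] Suc.prems by (cases "Z = {}") auto
  moreover have "card Z = card (Z - ?I) + card ?I"
    using card_Diff_subset[of ?I Z] card_mono[OF Suc.prems(1) I] I Suc.prems(1) by (simp add: finite_subset)
  ultimately show ?case by simp
qed simp

section \<open>Boundary edges and distance to the boundary\<close>

lemma shared_edge_in_boundary:
  assumes F: "is_binary_image F" and c: "c \<in> ones F" "c' \<notin> ones F" "neighbours c c'"
    and e: "e \<in> cell_edges c" "e \<in> cell_edges c'"
  shows "e \<in> image_boundary F"
proof (cases "c' \<in> image_cells F")
  case True
  then have "c' \<in> zeroes F" using F c(2) by (auto simp: is_binary_image_def ones_def zeroes_def)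
  then show ?thesis using c e unfolding image_boundary_def by blast
next
  case False
  have "c \<noteq> c'" using c by blast
  then have "{c'' \<in> image_cells F. e \<in> cell_edges c''} = {c}"
    using edge_at_most_two_cells[OF e] e c(1) False by (auto simp: ones_def)
  then show ?thesis using c(1) unfolding image_boundary_def by blast
qed

lemma finite_image_boundary: "finite (image_boundary F)"
proof (rule finite_subset)
  show "image_boundary F \<subseteq> \<Union>(cell_edges ` ones F)" by (auto simp: image_boundary_def)
  show "finite (\<Union>(cell_edges ` ones F))"
    using finite_ones by (auto simp: cell_edges_def)
qed

lemma perimeter_le_boundary_length:
  assumes F: "is_binary_image F"
  shows "perimeter (ones F) \<le> boundary_length F"
proof -
  let ?Z = "ones F"
  define A where "A = {c \<in> ?Z. c + (1, 0) \<notin> ?Z}"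
  define B where "B = {c \<in> ?Z. c + (0, 1) \<notin> ?Z}"
  define A' where "A' = {c \<in> ?Z. c - (1, 0) \<notin> ?Z}"
  define B' where "B' = {c \<in> ?Z. c - (0, 1) \<notin> ?Z}"
  \<comment> \<open>\<open>v\<close> and \<open>h\<close> give the left and the lower edge of a
    cell; right and upper edges are those of the next cell, whence the shifts in \<open>VA\<close>
    and \<open>HB\<close>.\<close>
  define v :: "cell \<Rightarrow> edge" where "v = (\<lambda>(x, y). {(x, y), (x, y + 1)})"
  define h :: "cell \<Rightarrow> edge" where "h = (\<lambda>(x, y). {(x, y), (x + 1, y)})"
  define VA where "VA = (\<lambda>c. c + (1, 0)) ` A"
  define HB where "HB = (\<lambda>c. c + (0, 1)) ` B"
  have f: "finite VA" "finite HB" "finite A'" "finite B'"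
    using finite_ones by (auto simp: A_def B_def A'_def B'_def VA_def HB_def)
  have "inj v" "inj h" by (auto simp: inj_def v_def h_def edge_eq_iff)
  then have inj: "inj_on v Y" "inj_on h Y" for Y by (auto intro: inj_on_subset)
  have "v ` (VA \<union> A') \<subseteq> image_boundary F"
    by (auto simp: v_def VA_def A_def A'_def vertical_edge_iff neighbours_iff
        intro!: shared_edge_in_boundary[OF F])
  moreover have "h ` (HB \<union> B') \<subseteq> image_boundary F"
    by (auto simp: h_def HB_def B_def B'_def horizontal_edge_iff neighbours_iff
        intro!: shared_edge_in_boundary[OF F])
  ultimately have "card (v ` (VA \<union> A') \<union> h ` (HB \<union> B')) \<le> boundary_length F"
    unfolding boundary_length_def by (intro card_mono finite_image_boundary) auto
  moreover have "card (v ` (VA \<union> A') \<union> h ` (HB \<union> B')) = card (v ` (VA \<union> A')) + card (h ` (HB \<union> B'))"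
    using f by (intro card_Un_disjoint) (auto simp: v_def h_def edge_eq_iff)
  \<comment> \<open>\<open>VA\<close> lies outside the ones and \<open>A'\<close> inside, so no edge
    is counted twice.\<close>
  moreover have "card (v ` (VA \<union> A')) = card VA + card A'"
    using f by (subst card_image[OF inj(1)], intro card_Un_disjoint) (auto simp: VA_def A_def A'_def)
  moreover have "card (h ` (HB \<union> B')) = card HB + card B'"
    using f by (subst card_image[OF inj(2)], intro card_Un_disjoint) (auto simp: HB_def B_def B'_def)
  moreover have "card VA = card A" "card HB = card B"
    unfolding VA_def HB_def by (auto intro!: card_image inj_onI)
  moreover have "card A' = card A" "card B' = card B"
    using runs_uminus[OF finite_ones[of F], of "(1, 0)"] runs_uminus[OF finite_ones[of F], of "(0, 1)"]
    by (simp_all add: A'_def B'_def A_def B_def runs_def)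
  ultimately show ?thesis by (simp add: perimeter_def runs_def A_def B_def)
qed

text \<open>Every edge of \<open>c\<close> is shared with exactly one other cell, which is a one;
  thus it neither borders a zero nor belongs to a single cell of the rectangle.\<close>

lemma interior_cells_no_boundary:
  assumes "is_binary_image F" "c \<in> interior_cells (ones F)"
  shows "cell_edges c \<inter> image_boundary F = {}"
proof (rule ccontr)
  assume "\<not> ?thesis"
  then obtain e where e: "e \<in> cell_edges c" "e \<in> image_boundary F" by blast
  have "\<exists>n. neighbours c n \<and> e \<in> cell_edges n"
    using e(1)
  proof (cases rule: edge_cases)
    case (1 a b)
    then have "c = (a, b) \<or> c = (a, b - 1)" using e(1) by (simp add: horizontal_edge_iff)
    then have "neighbours c (a, b - 1) \<or> neighbours c (a, b)" by (auto simp: neighbours_iff)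
    then show ?thesis using 1 horizontal_edge_iff by metis
  next
    case (2 a b)
    then have "c = (a, b) \<or> c = (a - 1, b)" using e(1) by (simp add: vertical_edge_iff)
    then have "neighbours c (a - 1, b) \<or> neighbours c (a, b)" by (auto simp: neighbours_iff)
    then show ?thesis using 2 vertical_edge_iff by metis
  qed
  then obtain n where n: "neighbours c n" "e \<in> cell_edges n" by blast
  have one: "c \<in> ones F" "n \<in> ones F" using assms(2) n(1) unfolding interior_cells_def by blast+
  have ne: "c \<noteq> n" using n(1) by (auto simp: neighbours_def)
  have two: "d = c \<or> d = n" if "e \<in> cell_edges d" for d
    using edge_at_most_two_cells[OF e(1) n(2) that ne] .
  show False
    using e(2) unfolding image_boundary_def
  proof
    assume "e \<in> {e. \<exists>c\<in>ones F. \<exists>c'\<in>zeroes F. neighbours c c' \<and> e \<in> cell_edges c \<inter> cell_edges c'}"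
    then obtain z where "z \<in> zeroes F" "e \<in> cell_edges z" by blast
    then show False using two[of z] one by (auto simp: ones_def zeroes_def)
  next
    assume "e \<in> {e. \<exists>c\<in>ones F. {c' \<in> image_cells F. e \<in> cell_edges c'} = {c}}"
    then obtain d where "{c' \<in> image_cells F. e \<in> cell_edges c'} = {d}" by blast
    moreover have "c \<in> {c' \<in> image_cells F. e \<in> cell_edges c'}" "n \<in> {c' \<in> image_cells F. e \<in> cell_edges c'}"
      using one e(1) n(2) by (auto simp: ones_def)
    ultimately show False using ne by simp
  qed
qed

text \<open>By the recursive equation, each passage to the interior raises the lower bound for the
  distance by one.\<close>

lemma boundary_distance_ge:
  assumes F: "is_binary_image F"
  shows "c \<in> (interior_cells ^^ k) (ones F) \<Longrightarrow> c \<in> ones F \<and> k \<le> boundary_distance F c"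
proof (induction k arbitrary: c)
  case (Suc k)
  let ?d = "boundary_distance F"
  let ?X = "(interior_cells ^^ k) (ones F)"
  have "c \<in> interior_cells ?X" using Suc.prems by simp
  then have c: "c \<in> ?X" "\<And>n. neighbours c n \<Longrightarrow> n \<in> ?X"
    unfolding interior_cells_def by blast+
  have "c \<in> interior_cells (ones F)" using c Suc.IH unfolding interior_cells_def by blast
  then have "cell_edges c \<inter> image_boundary F = {}" by (rule interior_cells_no_boundary[OF F])
  moreover have one: "c \<in> ones F" using c Suc.IH by blast
  ultimately have "?d c = 1 + Min (?d ` {c'. neighbours c c'})"
    using boundary_distance_equations[OF F] unfolding distance_equations_def by auto
  moreover have "k \<le> Min (?d ` {c'. neighbours c c'})"
    using neighbours_set[of c] c(2) Suc.IH by (subst Min_ge_iff) auto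
  ultimately show ?case using one by simp
qed simp

theorem theorem5:
  fixes F :: binary_image and N l :: nat
  assumes "is_binary_image F"
    and "N > 0" and "l > 0"
    and "card (ones F) = N"
    and "boundary_length F = l"
    and "\<forall>K\<in>image_components F. \<not> has_hole F K"
  shows "contains_ball F (nat \<lfloor>real N / real l\<rfloor>)"
proof -
  define k where "k = N div l"
  have k: "nat \<lfloor>real N / real l\<rfloor> = k"
    by (simp add: k_def floor_divide_of_nat_eq)
  have "(interior_cells ^^ k) (ones F) \<noteq> {}"
  proof
    assume E: "(interior_cells ^^ k) (ones F) = {}"
    have "N \<le> k * (l - 1)"
      using card_less_layers[OF finite_ones acyclic_ones[OF assms(1,6)] _ assms(3) E]
        perimeter_le_boundary_length[OF assms(1)] assms(4,5) by simp
    \<comment> \<open>Now \<open>k * l \<le> N \<le> k * l - k\<close> forces \<open>k = 0\<close>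
      and thus \<open>N = 0\<close>.\<close>
    moreover have "k * l \<le> N" by (simp add: k_def)
    moreover have "k * l = k * (l - 1) + k" using assms(3) by (cases l) auto
    ultimately show False using assms(2) by (cases k) auto
  qed
  then show ?thesis
    using boundary_distance_ge[OF assms(1)] unfolding k contains_ball_def by blast
qed

end
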